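(* Let $n\geq 3$ and $k\geq 3$ be odd integers, and let $G$ be a connected graph of order $n$. If $\rho(G)\geq \rho(K_1 \vee (K_{n-2}+K_1))$, then $G$ is $\mathrm{GFC}_k$ unless $G = K_1 \vee (K_{n-2}+K_1)$.
   Context: All graphs are finite, simple and undirected. The order of $G$ is its number of vertices. $\rho(G)$ is the largest eigenvalue of the adjacency matrix of $G$. $K_m$ is the complete graph on $m$ vertices, $G_1+G_2$ is the (vertex-disjoint) union, and the join $G_1\vee G_2$ is obtained from vertex-disjoint $G_1,G_2$ by adding all edges between $V(G_1)$ and $V(G_2)$. Equality of graphs means isomorphism. For a graph $H$, let $\mathrm{odd}(H)$ be the number of nontrivial odd components of $H$ (connected components with an odd number, at least $3$, of vertices) and $i(H)$ the number of isolated vertices of $H$. For odd $k$ define $$\mathrm{def}_k(G)=\max_{S\subseteq V(G)}\{\mathrm{odd}(G-S)+k\cdot i(G-S)-k|S|\}.$$ A $k$-barrier of $G$ is a subset $S\subseteq V(G)$ attaining this maximum. A graph $G$ of odd order is generalized factor-critical, written $\mathrm{GFC}_k$, if $\emptyset$ is its only $k$-barrier. *)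

theory Defs
  imports
    "Graph_Theory.Pair_Digraph"
    "Graph_Theory.Digraph_Component"
    "Graph_Theory.Digraph_Isomorphism"
    "Jordan_Normal_Form.Spectral_Radius"
begin

text \<open>
  Finite simple undirected graphs are the symmetric loop-free digraphs of the locale
  \<^locale>\<open>pair_graph\<close>: every edge is represented by its two orientations.
\<close>

definition complete_graph :: "nat \<Rightarrow> nat pair_pre_digraph" where
  "complete_graph m = \<lparr>pverts = {..<m}, parcs = {(u, v). u < m \<and> v < m \<and> u \<noteq> v}\<rparr>"

definition disjoint_union ::
    "'a pair_pre_digraph \<Rightarrow> 'b pair_pre_digraph \<Rightarrow> ('a + 'b) pair_pre_digraph" where
  "disjoint_union G H =
     \<lparr>pverts = pverts G <+> pverts H,
      parcs = map_prod Inl Inl ` parcs G \<union> map_prod Inr Inr ` parcs H\<rparr>"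

definition graph_join ::
    "'a pair_pre_digraph \<Rightarrow> 'b pair_pre_digraph \<Rightarrow> ('a + 'b) pair_pre_digraph" where
  "graph_join G H =
     \<lparr>pverts = pverts G <+> pverts H,
      parcs = parcs (disjoint_union G H)
        \<union> (Inl ` pverts G) \<times> (Inr ` pverts H) \<union> (Inr ` pverts H) \<times> (Inl ` pverts G)\<rparr>"

lemma pair_graph_complete_graph: "pair_graph (complete_graph m)"
proof
  show "finite (parcs (complete_graph m))"
    by (rule finite_subset[of _ "{..<m} \<times> {..<m}"]) (auto simp: complete_graph_def)
qed (auto simp: complete_graph_def symmetric_def sym_def)

lemma pair_graph_disjoint_union:
  assumes "pair_graph G" "pair_graph H"
  shows "pair_graph (disjoint_union G H)"
proof -
  interpret G: pair_graph G by fact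
  interpret H: pair_graph H by fact
  show ?thesis
    by unfold_locales
      (auto simp: disjoint_union_def symmetric_def sym_def
        dest: G.in_arcsD1 G.in_arcsD2 H.in_arcsD1 H.in_arcsD2 G.arcs_symmetric H.arcs_symmetric
          G.no_loops' H.no_loops')
qed

lemma pair_graph_graph_join:
  assumes "pair_graph G" "pair_graph H"
  shows "pair_graph (graph_join G H)"
proof -
  interpret G: pair_graph G by fact
  interpret H: pair_graph H by fact
  show ?thesis
    by unfold_locales
      (auto simp: graph_join_def disjoint_union_def symmetric_def sym_def
        dest: G.in_arcsD1 G.in_arcsD2 H.in_arcsD1 H.in_arcsD2 G.arcs_symmetric H.arcs_symmetric
          G.no_loops' H.no_loops')
qed


definition adj_matrix :: "('a, 'b) pre_digraph \<Rightarrow> 'a list \<Rightarrow> real mat" where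
  "adj_matrix G vs =
     mat (length vs) (length vs) (\<lambda>(i, j). if vs ! i \<rightarrow>\<^bsub>G\<^esub> vs ! j then 1 else 0)"

text \<open>
  The matrix depends on the enumeration of the vertices, its spectrum does not
  (see \<open>spectrum_adj_matrix_cong\<close> below). The term is meaningful for finite graphs with at least
  one vertex: then the set of real eigenvalues of the symmetric matrix is finite and nonempty.
\<close>
definition graph_rho :: "('a, 'b) pre_digraph \<Rightarrow> real" where
  "graph_rho G =
     Max (spectrum (adj_matrix G (SOME vs. distinct vs \<and> set vs = verts G)))"

lemma eigenvalue_adj_matrix_iff:
  assumes vs: "distinct vs" "set vs = verts G"
  shows "eigenvalue (adj_matrix G vs) x \<longleftrightarrow>
    (\<exists>f. (\<exists>v\<in>verts G. f v \<noteq> 0) \<and>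
      (\<forall>v\<in>verts G. (\<Sum>w\<in>verts G. if v \<rightarrow>\<^bsub>G\<^esub> w then f w else 0) = x * f v))"
    (is "?L \<longleftrightarrow> ?R")
proof -
  let ?n = "length vs" and ?A = "adj_matrix G vs"
  have bij: "bij_betw (\<lambda>i. vs ! i) {0..<?n} (verts G)"
    using bij_betw_nth[OF vs(1), of "{0..<?n}"] vs(2) by (auto simp: atLeast0LessThan)
  have mult: "(?A *\<^sub>v u) $ i =
      (\<Sum>w\<in>verts G. if vs ! i \<rightarrow>\<^bsub>G\<^esub> w then f w else 0)"
    if u: "u \<in> carrier_vec ?n" and i: "i < ?n" and f: "\<And>j. j < ?n \<Longrightarrow> u $ j = f (vs ! j)" for u i f
  proof -
    have "(?A *\<^sub>v u) $ i =
        (\<Sum>j = 0..<?n. if vs ! i \<rightarrow>\<^bsub>G\<^esub> vs ! j then f (vs ! j) else 0)"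
      using u i by (auto simp: adj_matrix_def scalar_prod_def f intro!: sum.cong)
    also have "\<dots> = (\<Sum>w\<in>verts G. if vs ! i \<rightarrow>\<^bsub>G\<^esub> w then f w else 0)"
      by (rule sum.reindex_bij_betw[OF bij])
    finally show ?thesis .
  qed
  have dim: "dim_row ?A = ?n" by (simp add: adj_matrix_def)
  show ?thesis
  proof
    assume ?L
    then obtain u where u: "u \<in> carrier_vec ?n" "u \<noteq> 0\<^sub>v ?n" "?A *\<^sub>v u = x \<cdot>\<^sub>v u"
      by (auto simp: eigenvalue_def eigenvector_def dim)
    define f where "f = (\<lambda>v. u $ (the_inv_into {0..<?n} (\<lambda>i. vs ! i) v))"
    have f: "u $ j = f (vs ! j)" if "j < ?n" for j
      using that bij by (simp add: f_def the_inv_into_f_f bij_betw_def)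
    have "\<exists>j<?n. u $ j \<noteq> 0" using u(1,2) by (auto intro!: eq_vecI)
    then have "\<exists>v\<in>verts G. f v \<noteq> 0" using f vs(2) by force
    moreover have "(\<Sum>w\<in>verts G. if v \<rightarrow>\<^bsub>G\<^esub> w then f w else 0) = x * f v"
      if "v \<in> verts G" for v
    proof -
      obtain i where i: "i < ?n" "v = vs ! i" using \<open>v \<in> verts G\<close> vs(2) by (metis in_set_conv_nth)
      then show ?thesis using mult[OF u(1) i(1) f] u(1,3) f by simp
    qed
    ultimately show ?R by blast
  next
    assume ?R
    then obtain f where f: "\<exists>v\<in>verts G. f v \<noteq> 0"
      "\<And>v. v \<in> verts G \<Longrightarrow>
        (\<Sum>w\<in>verts G. if v \<rightarrow>\<^bsub>G\<^esub> w then f w else 0) = x * f v" by blast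
    define u where "u = vec ?n (\<lambda>i. f (vs ! i))"
    have u: "u \<in> carrier_vec ?n" by (simp add: u_def)
    obtain i where "i < ?n" "f (vs ! i) \<noteq> 0" using f(1) vs(2) by (metis in_set_conv_nth)
    then have "u \<noteq> 0\<^sub>v ?n" unfolding u_def by (metis index_vec index_zero_vec(1))
    moreover have "?A *\<^sub>v u = x \<cdot>\<^sub>v u"
    proof (rule eq_vecI)
      fix i assume "i < dim_vec (x \<cdot>\<^sub>v u)"
      then have i: "i < ?n" using u by simp
      have "vs ! i \<in> verts G" using i vs(2) nth_mem by blast
      then show "(?A *\<^sub>v u) $ i = (x \<cdot>\<^sub>v u) $ i"
        using mult[OF u i, of f] f(2) i by (simp add: u_def)
    qed (simp add: u_def dim)
    ultimately show ?L using u by (auto simp: eigenvalue_def eigenvector_def dim)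
  qed
qed

lemma spectrum_adj_matrix_cong:
  assumes "distinct vs" "set vs = verts G" "distinct ws" "set ws = verts G"
  shows "spectrum (adj_matrix G vs) = spectrum (adj_matrix G ws)"
  unfolding spectrum_def
  by (rule Collect_cong) (simp only: eigenvalue_adj_matrix_iff[OF assms(1,2)] eigenvalue_adj_matrix_iff[OF assms(3,4)])

lemma graph_rho_eq:
  assumes "distinct vs" "set vs = verts G"
  shows "graph_rho G = Max (spectrum (adj_matrix G vs))"
proof -
  have "distinct (SOME vs. distinct vs \<and> set vs = verts G) \<and>
      set (SOME vs. distinct vs \<and> set vs = verts G) = verts G"
    by (rule someI[of _ vs]) (use assms in simp)
  then show ?thesis unfolding graph_rho_def using assms spectrum_adj_matrix_cong by metis
qed


text \<open>
  In a symmetric digraph the strongly connected components, given by their vertex sets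
  \<^const>\<open>pre_digraph.sccs_verts\<close>, are the connected components.
\<close>
definition num_odd_comps :: "('a, 'b) pre_digraph \<Rightarrow> nat" where
  "num_odd_comps G = card {C \<in> pre_digraph.sccs_verts G. odd (card C) \<and> 3 \<le> card C}"

definition num_isolated :: "('a, 'b) pre_digraph \<Rightarrow> nat" where
  "num_isolated G = card {v \<in> verts G. \<not> (\<exists>w. v \<rightarrow>\<^bsub>G\<^esub> w)}"

definition delete_verts :: "('a, 'b) pre_digraph \<Rightarrow> 'a set \<Rightarrow> ('a, 'b) pre_digraph" where
  "delete_verts G S = G \<restriction> (verts G - S)"

definition deficiency_at :: "nat \<Rightarrow> ('a, 'b) pre_digraph \<Rightarrow> 'a set \<Rightarrow> int" where
  "deficiency_at k G S =
     int (num_odd_comps (delete_verts G S)) + int k * int (num_isolated (delete_verts G S))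
       - int k * int (card S)"

definition deficiency :: "nat \<Rightarrow> ('a, 'b) pre_digraph \<Rightarrow> int" where
  "deficiency k G = Max (deficiency_at k G ` Pow (verts G))"

definition k_barrier :: "nat \<Rightarrow> ('a, 'b) pre_digraph \<Rightarrow> 'a set \<Rightarrow> bool" where
  "k_barrier k G S \<longleftrightarrow> S \<subseteq> verts G \<and> deficiency_at k G S = deficiency k G"

definition generalized_factor_critical :: "nat \<Rightarrow> ('a, 'b) pre_digraph \<Rightarrow> bool" where
  "generalized_factor_critical k G \<longleftrightarrow>
     odd (card (verts G)) \<and> {S. k_barrier k G S} = {{}}"

end

theory Submission
  imports Defs "HOL-Analysis.Convex"
begin

text \<open>
  The extremal graph \<open>K\<^sub>1 \<or> (K\<^sub>n\<^sub>-\<^sub>2 + K\<^sub>1)\<close> has spectral radius greater than \<open>n - 2\<close>, so the hypothesis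
  together with Hong's bound \<open>\<rho>\<^sup>2 \<le> 2e - n + 1\<close> leaves \<open>G\<close> with at most \<open>n - 2\<close> non-adjacent
  pairs of vertices. Since \<open>\<emptyset>\<close> has deficiency \<open>1\<close>, if \<open>G\<close> is not generalized factor-critical then
  for some nonempty \<open>S\<close> of size \<open>s\<close> the graph \<open>G - S\<close> has at least \<open>s + 1\<close> components, which
  forces \<open>s(2n - 3s - 1)/2\<close> non-adjacent pairs. The two bounds are compatible only for \<open>s = 1\<close>,
  where both are sharp and \<open>G\<close> is the extremal graph, and for \<open>s = 2\<close>, \<open>n = 5\<close>, where \<open>G\<close> is a
  subgraph of \<open>K\<^sub>2 \<or> 3K\<^sub>1\<close>, whose spectral radius is exactly \<open>3 = n - 2\<close>.
\<close>

section \<open>Real eigenvalues and upper bounds on them\<close>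

text \<open>A complex eigenvalue \<open>z\<close> exists; split its eigenvector into real and
  imaginary parts \<open>p\<close>, \<open>q\<close>. Symmetry equates q.Ap with p.Aq, where the
  \<open>Re z\<close> terms cancel, so \<open>Im z\<close> times a nonzero sum of squares vanishes.
  This makes the \<open>Max\<close> in \<open>graph_rho\<close> range over a nonempty set.\<close>

lemma symmetric_real_matrix_spectrum_nonempty:
  fixes A :: "real mat"
  assumes A: "A \<in> carrier_mat n n" and n: "n > 0"
    and sym: "\<And>i j. i < n \<Longrightarrow> j < n \<Longrightarrow> A $$ (i, j) = A $$ (j, i)"
  shows "spectrum A \<noteq> {}"
proof -
  define B where "B = map_mat complex_of_real A"
  have B: "B \<in> carrier_mat n n" using A by (simp add: B_def)
  obtain z where z: "eigenvalue B z"
    using spectrum_non_empty[OF B n] by (auto simp: spectrum_def)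
  then obtain u where u: "u \<in> carrier_vec n" "u \<noteq> 0\<^sub>v n" "B *\<^sub>v u = z \<cdot>\<^sub>v u"
    using B by (auto simp: eigenvalue_def eigenvector_def)
  have eq: "(\<Sum>j<n. of_real (A $$ (i, j)) * u $ j) = z * u $ i" if "i < n" for i
  proof -
    have "(B *\<^sub>v u) $ i = (\<Sum>j<n. of_real (A $$ (i, j)) * u $ j)"
      using that u(1) A by (simp add: B_def scalar_prod_def atLeast0LessThan)
    then show ?thesis using u that by simp
  qed
  define p where "p j = Re (u $ j)" for j
  define q where "q j = Im (u $ j)" for j
  have Ap: "(\<Sum>j<n. A $$ (i, j) * p j) = Re z * p i - Im z * q i" if "i < n" for i
    using arg_cong[OF eq[OF that], of Re] by (simp add: p_def q_def)
  have Aq: "(\<Sum>j<n. A $$ (i, j) * q j) = Re z * q i + Im z * p i" if "i < n" for i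
    using arg_cong[OF eq[OF that], of Im] by (simp add: p_def q_def)
  have "(\<Sum>i<n. q i * (\<Sum>j<n. A $$ (i, j) * p j)) = (\<Sum>j<n. \<Sum>i<n. q i * (A $$ (i, j) * p j))"
    unfolding sum_distrib_left by (rule sum.swap)
  also have "\<dots> = (\<Sum>i<n. p i * (\<Sum>j<n. A $$ (i, j) * q j))"
    unfolding sum_distrib_left by (intro sum.cong refl) (use sym in \<open>simp add: mult_ac\<close>)
  finally have "(\<Sum>i<n. q i * (Re z * p i - Im z * q i)) = (\<Sum>i<n. p i * (Re z * q i + Im z * p i))"
    by (simp add: Ap Aq)
  then have "(\<Sum>i<n. p i * (Re z * q i + Im z * p i) - q i * (Re z * p i - Im z * q i)) = 0"
    by (simp add: sum_subtractf)
  then have "Im z * (\<Sum>i<n. (p i)\<^sup>2 + (q i)\<^sup>2) = 0"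
    by (simp add: sum_distrib_left algebra_simps power2_eq_square)
  moreover have "(\<Sum>i<n. (p i)\<^sup>2 + (q i)\<^sup>2) \<noteq> 0"
  proof
    assume "(\<Sum>i<n. (p i)\<^sup>2 + (q i)\<^sup>2) = 0"
    then have "(p i)\<^sup>2 + (q i)\<^sup>2 = 0" if "i < n" for i
      using that by (subst (asm) sum_nonneg_eq_0_iff) auto
    then have "u $ i = 0" if "i < n" for i
      using that by (simp add: p_def q_def complex_eq_iff)
    then have "u = 0\<^sub>v n" using u(1) by (intro eq_vecI) auto
    with u(2) show False by simp
  qed
  ultimately have "z = of_real (Re z)" by (simp add: complex_eq_iff)
  \<comment> \<open>The characteristic polynomial brings the eigenvalue back to \<open>A\<close>
    without asking which of \<open>p\<close>, \<open>q\<close> is nonzero.\<close>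
  then have "poly (char_poly B) (of_real (Re z)) = 0"
    using z eigenvalue_root_char_poly[OF B] by metis
  then have "poly (char_poly A) (Re z) = 0"
    by (simp add: B_def of_real_hom.char_poly_hom[OF A])
  then show ?thesis using eigenvalue_root_char_poly[OF A] by (auto simp: spectrum_def)
qed

text \<open>Hong's bound \<open>x\<^sup>2 \<le> 2e - n + 1\<close>: the set below has \<open>n(n - 1) - 2e\<close> elements.
  Hong's Cauchy--Schwarz argument never uses the sign of \<open>f\<close>, so Perron--Frobenius is not
  needed.\<close>

lemma eigenvalue_nonadjacent_pairs_bound:
  fixes f :: "'a \<Rightarrow> real"
  assumes fin: "finite V"
    and irrefl: "\<And>v. v \<in> V \<Longrightarrow> \<not> E v v"
    and sym: "\<And>v w. E v w \<Longrightarrow> E w v"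
    and nbr: "\<And>v. v \<in> V \<Longrightarrow> \<exists>w\<in>V. E v w"
    and nz: "\<exists>v\<in>V. f v \<noteq> 0"
    and eig: "\<And>v. v \<in> V \<Longrightarrow> (\<Sum>w\<in>{w \<in> V. E v w}. f w) = x * f v"
  shows "x\<^sup>2 + card {(u, v). u \<in> V \<and> v \<in> V \<and> u \<noteq> v \<and> \<not> E u v} \<le> (real (card V) - 1)\<^sup>2"
proof -
  define T where "T = (\<Sum>v\<in>V. (f v)\<^sup>2)"
  define N where "N v = {w \<in> V. E v w}" for v
  define M where "M v = {w \<in> V. v \<noteq> w \<and> \<not> E v w}" for v
  define n where "n = real (card V)"
  have finN [simp]: "finite (N v)" "finite (M v)" for v using fin by (auto simp: N_def M_def)
  obtain a where a: "a \<in> V" "f a \<noteq> 0" using nz by blast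
  have T: "T > 0"
    unfolding T_def by (rule sum_pos2[OF fin a(1)]) (use a in auto)
  have split: "(\<Sum>w\<in>V. g w) = g v + (\<Sum>w\<in>N v. g w) + (\<Sum>w\<in>M v. g w)"
    if "v \<in> V" for v and g :: "'a \<Rightarrow> real"
  proof -
    have V: "V = insert v (N v \<union> M v)" using that by (auto simp: N_def M_def)
    have "v \<notin> N v \<union> M v" "N v \<inter> M v = {}" using irrefl that by (auto simp: N_def M_def)
    then show ?thesis by (subst V) (simp add: sum.union_disjoint)
  qed
  have card: "real (card (M v)) = n - 1 - real (card (N v))" if "v \<in> V" for v
    using split[OF that, of "\<lambda>_. 1"] by (simp add: n_def)
  \<comment> \<open>Write d for \<open>card (N v)\<close> and m for the sum of squares over
    \<open>M v\<close>. Cauchy-Schwarz bounds the left side by d * (T - (f v)^2 - m). Since d is at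
    least 1, the term d * m may be weakened to m, whose sum over all \<open>v\<close> is computed in
    \<open>swap\<close>.\<close>
  have step: "x\<^sup>2 * (f v)\<^sup>2 \<le> card (N v) * T - card (N v) * (f v)\<^sup>2 - (\<Sum>w\<in>M v. (f w)\<^sup>2)"
    if v: "v \<in> V" for v
  proof -
    have "card (N v) > 0" using nbr[OF v] by (auto simp: N_def card_gt_0_iff fin)
    then have "1 * (\<Sum>w\<in>M v. (f w)\<^sup>2) \<le> card (N v) * (\<Sum>w\<in>M v. (f w)\<^sup>2)"
      by (intro mult_right_mono sum_nonneg) auto
    moreover have "x\<^sup>2 * (f v)\<^sup>2 = (\<Sum>w\<in>N v. f w)\<^sup>2"
      using eig[OF v] by (simp add: N_def power_mult_distrib)
    moreover have "\<dots> \<le> (\<Sum>w\<in>N v. (f w)\<^sup>2) * card (N v)"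
      by (rule sum_squared_le_sum_of_squares)
    moreover have "T = (f v)\<^sup>2 + (\<Sum>w\<in>N v. (f w)\<^sup>2) + (\<Sum>w\<in>M v. (f w)\<^sup>2)"
      unfolding T_def by (rule split[OF v])
    ultimately show ?thesis by (simp add: algebra_simps)
  qed
  have swap: "(\<Sum>v\<in>V. \<Sum>w\<in>M v. (f w)\<^sup>2) = (\<Sum>w\<in>V. card (M w) * (f w)\<^sup>2)"
  proof -
    have "(\<Sum>v\<in>V. \<Sum>w\<in>M v. (f w)\<^sup>2) = (\<Sum>w\<in>V. \<Sum>v\<in>{v \<in> V. v \<noteq> w \<and> \<not> E v w}. (f w)\<^sup>2)"
      unfolding M_def by (rule sum.swap_restrict) (use fin in auto)
    also have "\<dots> = (\<Sum>w\<in>V. card (M w) * (f w)\<^sup>2)"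
      by (auto simp: M_def intro!: sum.cong arg_cong[of _ _ card] dest: sym)
    finally show ?thesis .
  qed
  have "x\<^sup>2 * T = (\<Sum>v\<in>V. x\<^sup>2 * (f v)\<^sup>2)" by (simp add: T_def sum_distrib_left)
  also have "\<dots> \<le> (\<Sum>v\<in>V. card (N v) * T - card (N v) * (f v)\<^sup>2 - (\<Sum>w\<in>M v. (f w)\<^sup>2))"
    by (intro sum_mono step)
  \<comment> \<open>After the swap, (f v)^2 has the coefficient
    \<open>card (N v) + card (M v)\<close>, which is n - 1 at every vertex.\<close>
  also have "\<dots> = (\<Sum>v\<in>V. real (card (N v)) * T - (n - 1) * (f v)\<^sup>2)"
    unfolding sum_subtractf swap
    by (simp add: sum_subtractf[symmetric] card algebra_simps sum.distrib[symmetric] cong: sum.cong)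
  also have "\<dots> = ((\<Sum>v\<in>V. real (card (N v))) - (n - 1)) * T"
    by (simp add: sum_subtractf T_def sum_distrib_left[symmetric] sum_distrib_right[symmetric] algebra_simps)
  finally have "x\<^sup>2 \<le> (\<Sum>v\<in>V. real (card (N v))) - (n - 1)"
    using T by simp
  also have "(\<Sum>v\<in>V. real (card (N v))) = (\<Sum>v\<in>V. n - 1 - card (M v))"
    by (intro sum.cong refl) (simp add: card)
  also have "\<dots> = n * (n - 1) - (\<Sum>v\<in>V. real (card (M v)))"
    by (simp add: sum_subtractf n_def algebra_simps)
  also have "(\<Sum>v\<in>V. real (card (M v))) = card (SIGMA v:V. M v)"
    using fin by simp
  also have "(SIGMA v:V. M v) = {(u, v). u \<in> V \<and> v \<in> V \<and> u \<noteq> v \<and> \<not> E u v}"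
    by (auto simp: M_def)
  finally show ?thesis by (simp add: n_def power2_eq_square algebra_simps)
qed

text \<open>A Collatz-Wielandt argument: take \<open>v\<close> where |f| / g attains its maximum t.
  Bounding |f| by t * g on the neighbours of \<open>v\<close> gives x * t * g v \<le> c * t * g v.
  It serves the one case in which the bound by nonadjacent pairs is too weak.\<close>

lemma eigenvalue_le_of_positive_test_function:
  fixes f g :: "'a \<Rightarrow> real"
  assumes fin: "finite V"
    and nz: "\<exists>v\<in>V. f v \<noteq> 0"
    and eig: "\<And>v. v \<in> V \<Longrightarrow> (\<Sum>w\<in>{w \<in> V. E v w}. f w) = x * f v"
    and pos: "\<And>v. v \<in> V \<Longrightarrow> g v > 0"
    and sup: "\<And>v. v \<in> V \<Longrightarrow> (\<Sum>w\<in>{w \<in> V. E v w}. g w) \<le> c * g v"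
  shows "x \<le> c"
proof -
  define t where "t = Max ((\<lambda>v. \<bar>f v\<bar> / g v) ` V)"
  have V: "V \<noteq> {}" using nz by auto
  have "t \<in> (\<lambda>v. \<bar>f v\<bar> / g v) ` V" unfolding t_def using fin V by (intro Max_in) auto
  then obtain v where v: "v \<in> V" "t = \<bar>f v\<bar> / g v" by auto
  have le: "\<bar>f w\<bar> \<le> t * g w" if "w \<in> V" for w
  proof -
    have "\<bar>f w\<bar> / g w \<le> t" unfolding t_def using fin that by simp
    then show ?thesis using pos[OF that] by (simp add: field_simps)
  qed
  have "t > 0"
  proof -
    obtain w where w: "w \<in> V" "f w \<noteq> 0" using nz by auto
    then have "0 < t * g w" using le[OF w(1)] by linarith
    then show ?thesis using pos[OF w(1)] by (simp add: zero_less_mult_iff)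
  qed
  have "x * (t * g v) = x * \<bar>f v\<bar>" using v pos[OF v(1)] by simp
  also have "\<dots> \<le> \<bar>x * f v\<bar>" by (simp add: abs_mult mult_right_mono)
  also have "\<dots> \<le> (\<Sum>w\<in>{w \<in> V. E v w}. \<bar>f w\<bar>)"
    unfolding eig[OF v(1), symmetric] by (rule sum_abs)
  also have "\<dots> \<le> (\<Sum>w\<in>{w \<in> V. E v w}. t * g w)" by (intro sum_mono le) auto
  also have "\<dots> = t * (\<Sum>w\<in>{w \<in> V. E v w}. g w)" by (simp add: sum_distrib_left)
  also have "\<dots> \<le> t * (c * g v)" using sup[OF v(1)] \<open>t > 0\<close> by (intro mult_left_mono) auto
  finally have "x * (t * g v) \<le> c * (t * g v)" by (simp add: mult_ac)
  then show ?thesis using \<open>t > 0\<close> pos[OF v(1)] by (simp add: mult_le_cancel_right)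
qed

section \<open>Counting nonadjacent pairs\<close>

text \<open>\<open>R\<close> is to hold one vertex from each of s + 1 components. Every vertex of
  \<open>U - R\<close> misses at least s members of \<open>R\<close>; these pairs are counted in
  both orientations, by \<open>X\<close> and its converse. The independent set \<open>R\<close>
  itself adds the s * (s + 1) ordered pairs of \<open>Y\<close>.\<close>

lemma card_nonadjacent_pairs_ge:
  assumes fin: "finite V" and RU: "R \<subseteq> U" "U \<subseteq> V" and R: "card R = Suc s"
    and sym: "\<And>v w. E v w \<Longrightarrow> E w v"
    and indep: "\<And>r r'. r \<in> R \<Longrightarrow> r' \<in> R \<Longrightarrow> \<not> E r r'"
    and one: "\<And>u. u \<in> U - R \<Longrightarrow> card {r \<in> R. E u r} \<le> 1"
  shows "s * (2 * card U - s - 1) \<le> card {(u, v). u \<in> V \<and> v \<in> V \<and> u \<noteq> v \<and> \<not> E u v}"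
    (is "_ \<le> card ?P")
proof -
  define X where "X = (SIGMA u:U - R. {r \<in> R. \<not> E u r})"
  define Y where "Y = (SIGMA u:R. R - {u})"
  have finU: "finite U" and finR: "finite R" using fin RU by (meson finite_subset)+
  have X: "s * (card U - Suc s) \<le> card X"
  proof -
    have "s \<le> card {r \<in> R. \<not> E u r}" if "u \<in> U - R" for u
    proof -
      have "{r \<in> R. \<not> E u r} = R - {r \<in> R. E u r}" by auto
      then have "card {r \<in> R. \<not> E u r} = card R - card {r \<in> R. E u r}"
        using finR by (simp add: card_Diff_subset)
      then show ?thesis using one[OF that] R by linarith
    qed
    then have "(\<Sum>u\<in>U - R. s) \<le> (\<Sum>u\<in>U - R. card {r \<in> R. \<not> E u r})" by (rule sum_mono)
    then show ?thesis using finU finR RU R by (simp add: X_def card_Diff_subset mult.commute)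
  qed
  have Y: "card Y = Suc s * s" using finR R by (simp add: Y_def)
  have finXY: "finite X" "finite Y" using finU finR by (auto simp: X_def Y_def)
  have "X \<inter> X\<inverse> = {}" "(X \<union> X\<inverse>) \<inter> Y = {}" by (auto simp: X_def Y_def)
  then have "card (X \<union> X\<inverse> \<union> Y) = card X + card X + card Y"
    using finXY by (simp add: card_Un_disjoint)
  moreover have "X \<union> X\<inverse> \<union> Y \<subseteq> ?P"
    using RU indep by (auto simp: X_def Y_def dest: sym)
  moreover have "finite ?P" by (rule finite_subset[of _ "V \<times> V"]) (use fin in auto)
  ultimately have "2 * (s * (card U - Suc s)) + Suc s * s \<le> card ?P"
    using X Y card_mono[of ?P "X \<union> X\<inverse> \<union> Y"] by linarith
  \<comment> \<open>This makes the truncated subtractions on both sides of the next equation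
    exact.\<close>
  moreover have "card U \<ge> Suc s" using card_mono[OF finU RU(1)] R by simp
  then have "2 * (s * (card U - Suc s)) + Suc s * s = s * (2 * card U - s - 1)"
    by (auto simp: le_iff_add algebra_simps)
  ultimately show ?thesis by simp
qed

section \<open>Spectral radius of a graph and of the extremal graph\<close>

text \<open>Together with \<open>eigenvalue_le_graph_rho\<close> this replaces matrices by functions
  on the vertices; later arguments reach \<open>graph_rho\<close> only through these two
  facts.\<close>

lemma graph_rho_eigenfunction:
  assumes "pair_graph G" "pverts G \<noteq> {}"
  shows "\<exists>f. (\<exists>v\<in>pverts G. f v \<noteq> 0) \<and> (\<forall>v\<in>pverts G.
    (\<Sum>w\<in>{w \<in> pverts G. (v, w) \<in> parcs G}. f w) = graph_rho (with_proj G) * f v)"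
proof -
  interpret pair_graph G by fact
  obtain vs where vs: "distinct vs" "set vs = verts (with_proj G)"
    using finite_distinct_list[OF pair_finite_verts] by auto
  define A where "A = adj_matrix (with_proj G) vs"
  have A: "A \<in> carrier_mat (length vs) (length vs)" by (simp add: A_def adj_matrix_def)
  have "spectrum A \<noteq> {}"
    using A
  proof (rule symmetric_real_matrix_spectrum_nonempty)
    show "length vs > 0" using vs assms(2) by auto
  qed (auto simp: A_def adj_matrix_def dest: arcs_symmetric)
  then have "Max (spectrum A) \<in> spectrum A" using card_finite_spectrum[OF A] by (intro Max_in)
  then have "eigenvalue A (graph_rho (with_proj G))"
    using graph_rho_eq[OF vs] by (simp add: A_def spectrum_def)
  then show ?thesis
    unfolding A_def eigenvalue_adj_matrix_iff[OF vs]
    by (simp add: sum.inter_filter pair_finite_verts)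
qed

lemma eigenvalue_le_graph_rho:
  assumes "pair_graph G" "\<exists>v\<in>pverts G. f v \<noteq> 0"
    and "\<And>v. v \<in> pverts G \<Longrightarrow> (\<Sum>w\<in>{w \<in> pverts G. (v, w) \<in> parcs G}. f w) = x * f v"
  shows "x \<le> graph_rho (with_proj G)"
proof -
  interpret pair_graph G by fact
  obtain vs where vs: "distinct vs" "set vs = verts (with_proj G)"
    using finite_distinct_list[OF pair_finite_verts] by auto
  define A where "A = adj_matrix (with_proj G) vs"
  have A: "A \<in> carrier_mat (length vs) (length vs)" by (simp add: A_def adj_matrix_def)
  have "eigenvalue A x"
    unfolding A_def eigenvalue_adj_matrix_iff[OF vs] using assms(2,3)
    by (intro exI[of _ f]) (simp add: sum.inter_filter pair_finite_verts)
  then show ?thesis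
    using card_finite_spectrum[OF A] graph_rho_eq[OF vs] by (simp add: A_def spectrum_def)
qed

lemma graph_rho_pendant_clique_gt:
  assumes m: "m \<ge> 1"
  shows "real m < graph_rho (with_proj
    (graph_join (complete_graph 1) (disjoint_union (complete_graph m) (complete_graph 1))))"
    (is "_ < graph_rho (with_proj ?H)")
proof -
  \<comment> \<open>An eigenvector that is constant on the clique: the values \<open>1\<close>, \<open>l\<close>, \<open>q\<close> at the pendant vertex,
    the cut vertex and the clique satisfy \<open>l q = (m - 1) q + l\<close> and \<open>l\<^sup>2 = m q + 1\<close>;
    eliminating \<open>q\<close> gives the cubic \<open>P\<close>.\<close>
  define P where "P l = (l\<^sup>2 - 1) * (l - real m + 1) - m * l" for l :: real
  have Pm: "P m = -1" and "P (real m + 1) = m * m + 3 * m"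
    by (simp_all add: P_def power2_eq_square algebra_simps)
  then have "P m \<le> 0" "0 \<le> P (real m + 1)" by simp_all
  then have "\<exists>l\<ge>real m. l \<le> real m + 1 \<and> P l = 0"
    by (intro IVT') (auto simp: P_def intro!: continuous_intros)
  then obtain l :: real where l: "l \<ge> m" "P l = 0" by blast
  \<comment> \<open>The value -1 of \<open>P\<close> at \<open>m\<close> excludes equality.
    Strictness is decisive for n = 5, where K_2 \<or> 3K_1 has spectral radius exactly n -
    2.\<close>
  then have lm: "l > m" using Pm by (cases "l = m") auto
  define q where "q = l / (l - m + 1)"
  have q: "(l - m + 1) * q = l" using lm by (simp add: q_def)
  \<comment> \<open>Multiplied by the positive factor \<open>l - m + 1\<close>, the difference of
    the two sides becomes \<open>- P l\<close>.\<close>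
  have q': "m * q + 1 = l * l"
  proof -
    have "(l - m + 1) * (m * q + 1 - l * l) = m * ((l - m + 1) * q) + (l - m + 1) * (1 - l * l)"
      by (simp add: algebra_simps)
    also have "\<dots> = m * l + (l - m + 1) * (1 - l * l)" by (simp only: q)
    also have "\<dots> = 0" using l(2) by (simp add: P_def power2_eq_square algebra_simps)
    finally show ?thesis using lm by simp
  qed
  define f :: "nat + nat + nat \<Rightarrow> real"
    where "f = case_sum (\<lambda>_. l) (case_sum (\<lambda>_. q) (\<lambda>_. 1))"
  have V: "pverts ?H = insert (Inl 0) (insert (Inr (Inr 0)) ((Inr \<circ> Inl) ` {..<m}))"
    by (auto simp: graph_join_def disjoint_union_def complete_graph_def)
  have "l \<le> graph_rho (with_proj ?H)"
  proof (rule eigenvalue_le_graph_rho)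
    show "pair_graph ?H"
      by (intro pair_graph_graph_join pair_graph_disjoint_union pair_graph_complete_graph)
    show "\<exists>v\<in>pverts ?H. f v \<noteq> 0" unfolding V by (simp add: f_def)
    fix v assume "v \<in> pverts ?H"
    then consider "v = Inl 0" | "v = Inr (Inr 0)" | i where "v = Inr (Inl i)" "i < m"
      unfolding V by auto
    then show "(\<Sum>w\<in>{w \<in> pverts ?H. (v, w) \<in> parcs ?H}. f w) = l * f v"
    proof cases
      case 1
      have "{w \<in> pverts ?H. (v, w) \<in> parcs ?H} = insert (Inr (Inr 0)) ((Inr \<circ> Inl) ` {..<m})"
        unfolding V 1 by (auto simp: graph_join_def disjoint_union_def complete_graph_def)
      also have "sum f \<dots> = 1 + m * q"
        by (subst sum.insert) (auto simp: sum.reindex inj_on_def f_def)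
      finally show ?thesis using q' by (simp add: 1 f_def)
    next
      case 2
      have "{w \<in> pverts ?H. (v, w) \<in> parcs ?H} = {Inl 0}"
        unfolding V 2 by (auto simp: graph_join_def disjoint_union_def complete_graph_def)
      then show ?thesis by (simp add: 2 f_def)
    next
      case 3
      have "{w \<in> pverts ?H. (v, w) \<in> parcs ?H} = insert (Inl 0) ((Inr \<circ> Inl) ` ({..<m} - {i}))"
        unfolding V 3(1) using 3(2)
        by (auto simp: graph_join_def disjoint_union_def complete_graph_def)
      also have "sum f \<dots> = l + (m - 1) * q"
        using 3(2) by (subst sum.insert) (auto simp: sum.reindex inj_on_def f_def of_nat_diff)
      finally show ?thesis using q 3(2) by (simp add: 3(1) f_def of_nat_diff algebra_simps)
    qed
  qed
  then show ?thesis using lm by simp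
qed

section \<open>Recognising the extremal graph\<close>

text \<open>An arc here is the pair of its ends, so the vertex map forces the arc map
  \<open>map_prod h h\<close>.\<close>

lemma digraph_iso_with_projI:
  assumes G: "pair_wf_digraph G" and H: "pair_wf_digraph H"
    and h: "bij_betw h (pverts G) (pverts H)"
    and arcs: "\<And>u v. u \<in> pverts G \<Longrightarrow> v \<in> pverts G \<Longrightarrow>
      (u, v) \<in> parcs G \<longleftrightarrow> (h u, h v) \<in> parcs H"
  shows "digraph_iso (with_proj G) (with_proj H)"
proof -
  interpret G: pair_wf_digraph G by fact
  interpret H: pair_wf_digraph H by fact
  have inj: "inj_on h (pverts G)" and img: "h ` pverts G = pverts H"
    using h by (auto simp: bij_betw_def)
  have arcs_img: "map_prod h h ` parcs G = parcs H"
  proof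
    show "map_prod h h ` parcs G \<subseteq> parcs H"
    proof
      fix e assume "e \<in> map_prod h h ` parcs G"
      then obtain u v where "(u, v) \<in> parcs G" "e = (h u, h v)" by auto
      then show "e \<in> parcs H" using arcs[of u v] G.in_arcsD1[of u v] G.in_arcsD2[of u v] by simp
    qed
    show "parcs H \<subseteq> map_prod h h ` parcs G"
    proof
      fix e assume e: "e \<in> parcs H"
      obtain x y where xy: "e = (x, y)" by fastforce
      then have "x \<in> h ` pverts G" "y \<in> h ` pverts G"
        using e H.in_arcsD1[of x y] H.in_arcsD2[of x y] img by auto
      then obtain u v where uv: "u \<in> pverts G" "v \<in> pverts G" "x = h u" "y = h v" by auto
      then have "(u, v) \<in> parcs G" using arcs[of u v] e xy by simp
      then show "e \<in> map_prod h h ` parcs G" using uv xy by force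
    qed
  qed
  have "inj_on (map_prod h h) (parcs G)"
    by (rule inj_on_subset[OF map_prod_inj_on[OF inj inj]]) (auto intro: G.in_arcsD1 G.in_arcsD2)
  then have "pre_digraph.digraph_isomorphism (with_proj G)
      \<lparr>iso_verts = h, iso_arcs = map_prod h h, iso_head = snd, iso_tail = fst\<rparr>"
    using inj G.wf_digraph_axioms by (simp add: pre_digraph.digraph_isomorphism_def)
  moreover have "with_proj H = app_iso
      \<lparr>iso_verts = h, iso_arcs = map_prod h h, iso_head = snd, iso_tail = fst\<rparr> (with_proj G)"
    by (simp add: app_iso_def img arcs_img with_proj_def)
  ultimately show ?thesis unfolding digraph_iso_def by blast
qed

text \<open>The condition on arcs describes a clique with a pendant vertex \<open>b\<close> attached
  at \<open>a\<close>. Send \<open>a\<close> to the joined vertex, \<open>b\<close> to the pendant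
  one, and the rest onto the clique by any bijection.\<close>

lemma digraph_iso_pendant_clique:
  assumes G: "pair_graph G" and ab: "a \<in> pverts G" "b \<in> pverts G" "a \<noteq> b"
    and card: "card (pverts G) = n"
    and arcs: "\<And>u v. u \<in> pverts G \<Longrightarrow> v \<in> pverts G \<Longrightarrow>
      (u, v) \<in> parcs G \<longleftrightarrow> u \<noteq> v \<and> (u = b \<longrightarrow> v = a) \<and> (v = b \<longrightarrow> u = a)"
  shows "digraph_iso (with_proj G) (with_proj
    (graph_join (complete_graph 1) (disjoint_union (complete_graph (n - 2)) (complete_graph 1))))"
    (is "digraph_iso _ (with_proj ?H)")
proof -
  interpret G: pair_graph G by fact
  interpret H: pair_graph ?H
    by (intro pair_graph_graph_join pair_graph_disjoint_union pair_graph_complete_graph)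
  let ?W = "pverts G - {a, b}"
  have "card ?W = n - 2" using ab card by (simp add: card_Diff_subset G.pair_finite_verts)
  then obtain g where g: "bij_betw g ?W {..<n - 2}"
    using finite_same_card_bij[of ?W "{..<n - 2}"] G.pair_finite_verts by auto
  define h where "h v = (if v = a then Inl 0 else if v = b then Inr (Inr 0) else Inr (Inl (g v)) :: nat + nat + nat)" for v
  have ha: "h a = Inl 0" and hb: "h b = Inr (Inr 0)" using ab(3) by (simp_all add: h_def)
  have g_less: "g v < n - 2" if "v \<in> pverts G" "v \<noteq> a" "v \<noteq> b" for v
    using g that by (auto simp: bij_betw_def)
  have g_eq: "g u = g v \<longleftrightarrow> u = v"
    if "u \<in> pverts G" "u \<noteq> a" "u \<noteq> b" "v \<in> pverts G" "v \<noteq> a" "v \<noteq> b" for u v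
    using g that by (auto simp: bij_betw_def inj_on_def)
  have V: "pverts ?H = insert (Inl 0) (insert (Inr (Inr 0)) ((Inr \<circ> Inl) ` {..<n - 2}))"
    by (auto simp: graph_join_def disjoint_union_def complete_graph_def)
  have "h ` pverts G = insert (h a) (insert (h b) (h ` ?W))" using ab by auto
  also have "h ` ?W = (Inr \<circ> Inl) ` g ` ?W" by (auto simp: h_def image_iff)
  also have "g ` ?W = {..<n - 2}" using g by (simp add: bij_betw_def)
  finally have img: "h ` pverts G = pverts ?H" by (simp only: V ha hb)
  have inj: "inj_on h (pverts G)"
    by (rule inj_onI) (auto simp: h_def g_eq split: if_splits)
  show ?thesis
  proof (rule digraph_iso_with_projI)
    show "bij_betw h (pverts G) (pverts ?H)" using inj img by (simp add: bij_betw_def)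
    fix u v assume uv: "u \<in> pverts G" "v \<in> pverts G"
    show "(u, v) \<in> parcs G \<longleftrightarrow> (h u, h v) \<in> parcs ?H"
      unfolding arcs[OF uv]
      using uv ab(3) by (auto simp: h_def graph_join_def disjoint_union_def complete_graph_def g_eq g_less image_iff bex_Un)
  qed (rule G.pair_wf_digraph H.pair_wf_digraph)+
qed

section \<open>Vertex deletion and components\<close>

lemma (in wf_digraph) reachable_imp_out_neighbour:
  assumes "u \<rightarrow>\<^sup>*\<^bsub>G\<^esub> v" "u \<noteq> v"
  shows "\<exists>w. u \<rightarrow>\<^bsub>G\<^esub> w"
  using assms by (induction rule: converse_reachable_induct) auto

text \<open>In this form the graph after deletion can be interpreted as a \<open>pair_graph\<close>
  again.\<close>

lemma delete_verts_with_proj: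
  "delete_verts (with_proj G) S =
    with_proj \<lparr>pverts = pverts G - S, parcs = parcs G \<inter> (pverts G - S) \<times> (pverts G - S)\<rparr>"
  by (auto simp: delete_verts_def induce_subgraph_def with_proj_def)

lemma (in pair_graph) pair_graph_delete_verts:
  "pair_graph \<lparr>pverts = pverts G - S, parcs = parcs G \<inter> (pverts G - S) \<times> (pverts G - S)\<rparr>"
  by unfold_locales
    (auto simp: pair_finite_verts pair_finite_arcs symmetric_def sym_def
      dest: arcs_symmetric no_loops')

context pair_graph
begin

lemma sccs_verts_closed:
  assumes "C \<in> sccs_verts" "u \<in> C" "(u, v) \<in> parcs G"
  shows "v \<in> C"
proof -
  have "u \<rightarrow>\<^sup>*\<^bsub>with_proj G\<^esub> v" "v \<rightarrow>\<^sup>*\<^bsub>with_proj G\<^esub> u" using assms(3) arcs_symmetric by auto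
  then show ?thesis using assms(1,2) by (auto simp: in_sccs_verts_conv_reachable)
qed

text \<open>Isolated vertices are singleton components, hence distinct from the odd components
  counted, which have at least 3 vertices.\<close>

lemma num_odd_comps_plus_num_isolated_le:
  "num_odd_comps (with_proj G) + num_isolated (with_proj G) \<le> card sccs_verts"
proof -
  define I where "I = {v \<in> pverts G. \<not> (\<exists>w. (v, w) \<in> parcs G)}"
  define O3 where "O3 = {C \<in> sccs_verts. odd (card C) \<and> 3 \<le> card C}"
  have sing: "{v} \<in> sccs_verts" if v: "v \<in> I" for v
  proof -
    have "\<not> v \<rightarrow>\<^sup>*\<^bsub>with_proj G\<^esub> w" if "w \<noteq> v" for w
      using reachable_imp_out_neighbour[of v w] v that by (auto simp: I_def)
    then show ?thesis using v by (auto simp: in_sccs_verts_conv_reachable I_def)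
  qed
  have fin: "finite sccs_verts" by (rule finite_sccs_verts)
  have "card (O3 \<union> (\<lambda>v. {v}) ` I) = card O3 + card I"
    using fin pair_finite_verts
    by (subst card_Un_disjoint) (auto simp: O3_def I_def card_image)
  moreover have "card (O3 \<union> (\<lambda>v. {v}) ` I) \<le> card sccs_verts"
    using fin sing by (intro card_mono) (auto simp: O3_def)
  ultimately show ?thesis
    by (simp add: num_odd_comps_def num_isolated_def O3_def I_def)
qed

text \<open>Choose one vertex in each of t components. No arc leaves a component, so representatives
  are pairwise nonadjacent, and all neighbours of \<open>u\<close> lie in the component of
  \<open>u\<close>, which has at most one representative.\<close>

lemma ex_component_representatives:
  assumes "t \<le> card sccs_verts"
  shows "\<exists>R \<subseteq> pverts G. card R = t \<and> (\<forall>r\<in>R. \<forall>r'\<in>R. (r, r') \<notin> parcs G) \<and>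
    (\<forall>u. card {r \<in> R. (u, r) \<in> parcs G} \<le> 1)"
proof -
  obtain F where F: "F \<subseteq> sccs_verts" "card F = t" "finite F"
    using obtain_subset_with_card_n[OF assms] by blast
  define r where "r C = (SOME v. v \<in> C)" for C :: "'a set"
  have r: "r C \<in> C" if "C \<in> F" for C
    using that F(1) unfolding r_def by (auto simp: in_sccs_verts_conv_reachable some_in_eq)
  have same: "C = D" if "C \<in> F" "D \<in> F" "u \<in> C" "u \<in> D" for C D u
    using sccs_verts_disjoint that F(1) by blast
  have inj: "inj_on r F" by (rule inj_onI) (metis r same)
  have "r ` F \<subseteq> pverts G" using r F(1) sccs_verts_subsets by blast
  moreover have "card (r ` F) = t" using inj F(2) by (simp add: card_image)
  moreover have "(r C, r D) \<notin> parcs G" if "C \<in> F" "D \<in> F" for C D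
    using that r same sccs_verts_closed F(1) no_loops' by (metis subsetD)
  moreover have "card {x \<in> r ` F. (u, x) \<in> parcs G} \<le> 1" for u
  proof -
    have "r C = r D" if "C \<in> F" "D \<in> F" "(u, r C) \<in> parcs G" "(u, r D) \<in> parcs G" for C D
      using that r same sccs_verts_closed F(1) arcs_symmetric by (metis subsetD)
    then show ?thesis using F(3) by (auto simp: card_le_Suc0_iff_eq)
  qed
  ultimately show ?thesis by (intro exI[of _ "r ` F"]) blast
qed

end

section \<open>Consequences of the counts\<close>

text \<open>Over the integers \<open>le\<close> factors as (s - 1) * (2n - 3s - 4) \<le> 0. Hence 2n
  \<le> 3s + 4, while \<open>n\<close> gives 2n \<ge> 4s + 2, so s is at most 2.\<close>

lemma component_count_inequality:
  fixes s n :: nat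
  assumes n: "2 * s + 1 \<le> n" and s: "s \<ge> 2"
    and le: "s * (2 * (n - s) - s - 1) + 4 \<le> 2 * n"
  shows "s = 2 \<and> n = 5"
proof -
  \<comment> \<open>Substituting for \<open>n\<close> removes the truncated subtraction before the
    passage to \<open>int\<close>.\<close>
  obtain d where d: "n = 2 * s + 1 + d" using n by (auto simp: le_iff_add)
  have "2 * (n - s) - s - 1 = s + 1 + 2 * d" unfolding d by simp
  then have "int (s * (2 * (n - s) - s - 1)) = int s * (2 * int n - 3 * int s - 1)"
    by (simp add: d algebra_simps)
  then have "int s * (2 * int n - 3 * int s - 1) + 4 \<le> 2 * int n" using le by linarith
  then have "(int s - 1) * (2 * int n - 3 * int s - 4) \<le> 0" by (simp add: algebra_simps)
  then have "2 * int n \<le> 3 * int s + 4" using s by (simp add: mult_le_0_iff)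
  then show ?thesis using n s by linarith
qed

text \<open>The hypothesis says (a - 1) * (b - 1) \<le> 0. It is applied to the sizes of the two
  sides left by a cut vertex.\<close>

lemma product_le_sum_imp_eq_1:
  fixes a b :: nat
  assumes "a \<ge> 1" "b \<ge> 1" "a * b + 1 \<le> a + b"
  shows "a = 1 \<or> b = 1"
proof -
  obtain c d where cd: "a = 1 + c" "b = 1 + d" using assms(1,2) by (auto simp: le_iff_add)
  have "c * d = 0" using assms(3) unfolding cd by (simp add: algebra_simps)
  then show ?thesis using cd by auto
qed

text \<open>The 2(n - 2) ordered pairs between \<open>b\<close> and \<open>B\<close> already exhaust
  the number allowed by \<open>few\<close>. All other pairs of distinct vertices are therefore
  adjacent, including \<open>a\<close> and \<open>b\<close>.\<close>

lemma nonadjacent_pairs_pendant: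
  assumes G: "pair_graph G" and a: "a \<in> pverts G" and b: "b \<in> pverts G" "b \<noteq> a"
    and card: "card (pverts G) = n" and n: "n \<ge> 3"
    and B: "B = pverts G - {a, b}"
    and no: "\<And>v. v \<in> B \<Longrightarrow> (b, v) \<notin> parcs G"
    and few: "card {(u, v). u \<in> pverts G \<and> v \<in> pverts G \<and> u \<noteq> v \<and> (u, v) \<notin> parcs G} + 4 \<le> 2 * n"
      (is "card ?P + 4 \<le> _")
  shows "digraph_iso (with_proj G) (with_proj
    (graph_join (complete_graph 1) (disjoint_union (complete_graph (n - 2)) (complete_graph 1))))"
proof -
  interpret pair_graph G by fact
  have finP: "finite ?P" by (rule finite_subset[of _ "pverts G \<times> pverts G"]) (auto simp: pair_finite_verts)
  have no': "(v, b) \<notin> parcs G" if "v \<in> B" for v using no[OF that] arcs_symmetric by blast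
  have cB: "card B = n - 2" "finite B" using a b card by (auto simp: B card_Diff_subset pair_finite_verts)
  have "card ({b} \<times> B \<union> B \<times> {b}) = 2 * (n - 2)"
    using cB by (subst card_Un_disjoint) (auto simp: card_cartesian_product B)
  moreover have "{b} \<times> B \<union> B \<times> {b} \<subseteq> ?P" using no no' b by (auto simp: B)
  ultimately have eq: "{b} \<times> B \<union> B \<times> {b} = ?P" using few n finP by (intro card_seteq) auto
  show ?thesis
  proof (rule digraph_iso_pendant_clique[OF G a b(1) _ card])
    fix u v assume uv: "u \<in> pverts G" "v \<in> pverts G"
    have "(u, v) \<in> parcs G \<longleftrightarrow> u \<noteq> v \<and> (u, v) \<notin> ?P" using uv no_loops' by auto
    also have "\<dots> \<longleftrightarrow> u \<noteq> v \<and> (u = b \<longrightarrow> v = a) \<and> (v = b \<longrightarrow> u = a)"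
      unfolding eq[symmetric] using uv by (auto simp: B)
    finally show "(u, v) \<in> parcs G \<longleftrightarrow> u \<noteq> v \<and> (u = b \<longrightarrow> v = a) \<and> (v = b \<longrightarrow> u = a)" .
  qed (use b in auto)
qed

section \<open>Deficiency of nonempty sets and the theorem\<close>

text \<open>The threshold 1 is the value that \<open>deficiency_at_empty_ge\<close> guarantees for
  the empty set, so \<open>S\<close> cannot be a k-barrier.\<close>

lemma no_nonempty_set_of_positive_deficiency:
  fixes G :: "'a pair_pre_digraph"
  assumes n: "n \<ge> 3" and k: "k \<ge> 1"
    and G: "pair_graph G" and conn: "Digraph_Component.connected (with_proj G)"
    and card: "card (pverts G) = n"
    and rho: "graph_rho (with_proj G) > real n - 2"
    and niso: "\<not> digraph_iso (with_proj G) (with_proj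
        (graph_join (complete_graph 1) (disjoint_union (complete_graph (n - 2)) (complete_graph 1))))"
    and S: "S \<subseteq> pverts G" "S \<noteq> {}"
  shows "deficiency_at k (with_proj G) S < 1"
proof (rule ccontr)
  assume "\<not> ?thesis"
  then have def: "deficiency_at k (with_proj G) S \<ge> 1" by simp
  interpret pair_graph G by fact
  define V where "V = pverts G"
  define U where "U = V - S"
  define H where "H = \<lparr>pverts = pverts G - S, parcs = parcs G \<inter> (pverts G - S) \<times> (pverts G - S)\<rparr>"
  define s where "s = card S"
  define P where "P = {(u, v). u \<in> V \<and> v \<in> V \<and> u \<noteq> v \<and> (u, v) \<notin> parcs G}"
  interpret H: pair_graph H unfolding H_def by (rule pair_graph_delete_verts)
  have H: "delete_verts (with_proj G) S = with_proj H" unfolding H_def by (rule delete_verts_with_proj)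
  have vH: "pverts H = U" and aH: "\<And>u v. (u, v) \<in> parcs H \<longleftrightarrow> (u, v) \<in> parcs G \<and> u \<in> U \<and> v \<in> U"
    by (auto simp: H_def U_def V_def)
  have fin: "finite V" "finite S" "finite U"
    using pair_finite_verts finite_subset[OF S(1)] by (auto simp: V_def U_def)
  have s: "s \<ge> 1" using S(2) fin by (simp add: s_def Suc_le_eq card_gt_0_iff)
  have cU: "card U = n - s" "s \<le> n"
    using S(1) fin card card_mono[of V S] by (auto simp: U_def V_def s_def card_Diff_subset)
  \<comment> \<open>Raising the weight of the odd components from 1 to \<open>k\<close> lets
    \<open>k\<close> be cancelled.\<close>
  have "Suc s \<le> num_odd_comps (with_proj H) + num_isolated (with_proj H)"
  proof -
    let ?q = "num_odd_comps (with_proj H)" and ?i = "num_isolated (with_proj H)"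
    have "int k * int s < int ?q + int k * int ?i"
      using def by (simp add: deficiency_at_def H s_def)
    also have "\<dots> \<le> int k * int ?q + int k * int ?i"
      using k mult_right_mono[of 1 "int k" "int ?q"] by simp
    finally have "int k * int s < int k * int (?q + ?i)" by (simp add: algebra_simps)
    then show ?thesis using k by (simp add: mult_less_cancel_left)
  qed
  then have comps: "Suc s \<le> card H.sccs_verts"
    using H.num_odd_comps_plus_num_isolated_le by linarith
  obtain R where R: "R \<subseteq> U" "card R = Suc s"
    "\<And>r r'. r \<in> R \<Longrightarrow> r' \<in> R \<Longrightarrow> (r, r') \<notin> parcs G"
    "\<And>u. u \<in> U \<Longrightarrow> card {r \<in> R. (u, r) \<in> parcs G} \<le> 1"
  proof -
    obtain R where *: "R \<subseteq> U" "card R = Suc s"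
      "\<forall>r\<in>R. \<forall>r'\<in>R. (r, r') \<notin> parcs H" "\<forall>u. card {r \<in> R. (u, r) \<in> parcs H} \<le> 1"
      using H.ex_component_representatives[OF comps] unfolding vH by blast
    have "{r \<in> R. (u, r) \<in> parcs G} = {r \<in> R. (u, r) \<in> parcs H}" if "u \<in> U" for u
      using *(1) that by (auto simp: aH)
    then show thesis using * by (intro that[of R]) (simp_all, metis aH subsetD)
  qed
  have nbr: "\<exists>w\<in>V. (v, w) \<in> parcs G" if v: "v \<in> V" for v
  proof -
    have "card (V - {v}) \<noteq> 0" using card n v fin by (simp add: V_def)
    then obtain w where w: "w \<in> V" "w \<noteq> v" using fin(1) by (metis Diff_iff card.empty ex_in_conv insertI1)
    have "v \<rightarrow>\<^sup>*\<^bsub>with_proj G\<^esub> w"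
      using symmetric_connected_imp_strongly_connected[OF sym_arcs conn] v w(1)
      by (simp add: strongly_connected_def V_def)
    then show ?thesis using reachable_imp_out_neighbour[of v w] w(2) in_arcsD2 by (auto simp: V_def)
  qed
  obtain f where f: "\<exists>v\<in>V. f v \<noteq> 0"
    "\<And>v. v \<in> V \<Longrightarrow> (\<Sum>w\<in>{w \<in> V. (v, w) \<in> parcs G}. f w) = graph_rho (with_proj G) * f v"
  proof -
    have "pverts G \<noteq> {}" using card n by auto
    then show thesis using graph_rho_eigenfunction[OF G] that unfolding V_def by blast
  qed
  \<comment> \<open>Here (n - 1)^2 - (n - 2)^2 = 2n - 3, and the strict bound on
    \<open>graph_rho\<close> leaves at most 2n - 4 ordered pairs.\<close>
  have few: "card P + 4 \<le> 2 * n"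
  proof -
    have "(graph_rho (with_proj G))\<^sup>2 + card P \<le> (real n - 1)\<^sup>2"
    proof -
      have "(v, v) \<notin> parcs G" for v using no_loops' by blast
      then show ?thesis
        using eigenvalue_nonadjacent_pairs_bound[OF fin(1), of "\<lambda>u v. (u, v) \<in> parcs G", OF _ arcs_symmetric nbr f]
        by (simp add: P_def V_def card)
    qed
    moreover have "(real n - 2)\<^sup>2 < (graph_rho (with_proj G))\<^sup>2"
      using rho n by (intro power_strict_mono) auto
    ultimately have "(real n - 2)\<^sup>2 + card P < (real n - 1)\<^sup>2" by linarith
    then have "real (card P) + 3 < 2 * real n" by (simp add: power2_eq_square algebra_simps)
    then show ?thesis by linarith
  qed
  have "s * (2 * card U - s - 1) \<le> card P"
    unfolding P_def
    by (rule card_nonadjacent_pairs_ge[OF fin(1) R(1) _ R(2)])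
      (use R(3,4) arcs_symmetric in \<open>auto simp: U_def\<close>)
  then have "s * (2 * (n - s) - s - 1) \<le> card P" by (simp add: cU)
  then have ineq: "s * (2 * (n - s) - s - 1) + 4 \<le> 2 * n" using few by linarith
  have "Suc s \<le> card U" using card_mono[OF fin(3) R(1)] R(2) by simp
  then have ns: "2 * s + 1 \<le> n" using cU by linarith
  show False
  proof (cases "s = 1")
    case True
    then obtain a where a: "S = {a}" by (auto simp: s_def card_1_singleton_iff)
    have cU: "card U = n - 1" using cU True by simp
    have "\<not> card H.sccs_verts \<le> 1" using comps True by simp
    then obtain A A' where A: "A \<in> H.sccs_verts" "A' \<in> H.sccs_verts" "A \<noteq> A'"
      using H.finite_sccs_verts by (auto simp: card_le_Suc0_iff_eq)
    \<comment> \<open>For s = 1 split \<open>U\<close> into one component \<open>A\<close> and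
      everything else. No edge joins the sides, so 2|A||B| \<le> 2n - 4 with |A| + |B| = n - 1,
      which forces one side to be a single vertex \<open>b\<close>.\<close>
    define B where "B = U - A"
    have AU: "A \<subseteq> U" "A \<noteq> {}" using H.sccs_verts_subsets[OF A(1)] A(1)
      by (auto simp: vH H.in_sccs_verts_conv_reachable)
    have "A' \<subseteq> B" "A' \<noteq> {}" using H.sccs_verts_subsets[OF A(2)] A(2) H.sccs_verts_disjoint[OF A]
      by (auto simp: B_def vH H.in_sccs_verts_conv_reachable)
    then have B: "B \<noteq> {}" by auto
    have AB: "(u, v) \<notin> parcs G" "(v, u) \<notin> parcs G" if "u \<in> A" "v \<in> B" for u v
      using H.sccs_verts_closed[OF A(1) that(1), of v] that AU arcs_symmetric[of v u]
      by (auto simp: B_def aH)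
    have fAB: "finite A" "finite B" using AU fin finite_subset by (auto simp: B_def)
    have sum: "card A + card B = n - 1"
      using cU AU fAB card_mono[OF fin(3) AU(1)] by (simp add: B_def card_Diff_subset)
    have finP: "finite P" by (rule finite_subset[of _ "V \<times> V"]) (auto simp: P_def fin)
    have "card (A \<times> B \<union> B \<times> A) = 2 * (card A * card B)"
      using fAB by (subst card_Un_disjoint) (auto simp: card_cartesian_product B_def)
    moreover have "card (A \<times> B \<union> B \<times> A) \<le> card P"
      using AB AU finP by (intro card_mono) (auto simp: P_def B_def U_def)
    ultimately have "card A * card B + 1 \<le> card A + card B" using few sum by linarith
    moreover have "card A \<ge> 1" "card B \<ge> 1" using AU B fAB by (auto simp: Suc_le_eq card_gt_0_iff)
    ultimately have "card A = 1 \<or> card B = 1" by (intro product_le_sum_imp_eq_1)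
    then obtain b C where b: "b \<in> U" "C = U - {b}" "\<And>v. v \<in> C \<Longrightarrow> (b, v) \<notin> parcs G"
    proof
      assume "card A = 1"
      then obtain b where "A = {b}" by (auto simp: card_1_singleton_iff)
      then show ?thesis using AB AU by (intro that[of b B]) (auto simp: B_def)
    next
      assume "card B = 1"
      then obtain b where b: "B = {b}" by (auto simp: card_1_singleton_iff)
      then have "A = U - {b}" using AU by (auto simp: B_def)
      moreover have "(b, v) \<notin> parcs G" if "v \<in> A" for v using AB(2)[OF that, of b] b by simp
      moreover have "b \<in> U" using b by (auto simp: B_def)
      ultimately show ?thesis by (rule that[rotated])
    qed
    have "digraph_iso (with_proj G) (with_proj
        (graph_join (complete_graph 1) (disjoint_union (complete_graph (n - 2)) (complete_graph 1))))"
      by (rule nonadjacent_pairs_pendant[OF G, of a b n C])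
        (use a b S card n few in \<open>auto simp: U_def V_def P_def\<close>)
    then show False using niso by simp
  next
    case False
    then have sn: "s = 2" "n = 5" using component_count_inequality[OF ns _ ineq] s by auto
    \<comment> \<open>Both sets have 3 elements, so \<open>U\<close> is independent. The count of
      pairs only yields rho^2 \<le> 10 here, which does not contradict rho > 3; hence the test
      function.\<close>
    have "R = U" using R cU sn fin by (intro card_subset_eq) auto
    then have UU: "(u, v) \<notin> parcs G" if "u \<in> U" "v \<in> U" for u v using R(3) that by simp
    \<comment> \<open>the Perron vector of \<open>K\<^sub>2 \<or> 3K\<^sub>1\<close>, up to scaling\<close>
    define g :: "'a \<Rightarrow> real" where "g v = (if v \<in> S then 3 else 2)" for v
    have gS: "sum g S = 6" using sn by (simp add: g_def s_def)
    have gU: "sum g U = 6"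
    proof -
      have "sum g U = (\<Sum>v\<in>U. 2)" by (intro sum.cong) (auto simp: g_def U_def)
      then show ?thesis using cU sn by simp
    qed
    have VSU: "V = S \<union> U" "S \<inter> U = {}" using S by (auto simp: U_def V_def)
    have "graph_rho (with_proj G) \<le> 3"
    proof (rule eigenvalue_le_of_positive_test_function[OF fin(1) f])
      show "g v > 0" for v by (simp add: g_def)
      fix v assume v: "v \<in> V"
      show "(\<Sum>w\<in>{w \<in> V. (v, w) \<in> parcs G}. g w) \<le> 3 * g v"
      \<comment> \<open>The total weight is 12. A vertex of \<open>S\<close> sees at most 12 - 3 = 3
        * 3, a vertex of \<open>U\<close> at most the weight 6 = 3 * 2 of \<open>S\<close>.\<close>
      proof (cases "v \<in> S")
        case True
        have "(\<Sum>w\<in>{w \<in> V. (v, w) \<in> parcs G}. g w) \<le> sum g (V - {v})"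
          using fin no_loops' by (intro sum_mono2) (auto simp: g_def)
        also have "\<dots> = sum g S + sum g U - g v"
          using v fin VSU by (simp add: sum_diff1 sum.union_disjoint)
        finally show ?thesis using True gS gU by (simp add: g_def)
      next
        case False
        then have "v \<in> U" using v by (simp add: U_def)
        then have "(\<Sum>w\<in>{w \<in> V. (v, w) \<in> parcs G}. g w) \<le> sum g S"
          using fin UU VSU by (intro sum_mono2) (auto simp: g_def)
        then show ?thesis using False gS by (simp add: g_def)
      qed
    qed
    then show False using rho sn by simp
  qed
qed

text \<open>By connectedness the whole vertex set is one component, of odd size at least 3, and it
  contributes 1.\<close>

lemma (in pair_graph) deficiency_at_empty_ge:
  assumes conn: "Digraph_Component.connected (with_proj G)"
    and card: "odd (card (pverts G))" "card (pverts G) \<ge> 3"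
  shows "1 \<le> deficiency_at k (with_proj G) {}"
proof -
  have G: "delete_verts (with_proj G) {} = with_proj G"
    unfolding delete_verts_with_proj
    using in_arcsD1 in_arcsD2 by (intro arg_cong[of _ _ with_proj] pair_pre_digraph.equality) auto
  have "pverts G \<in> sccs_verts"
    using symmetric_connected_imp_strongly_connected[OF sym_arcs conn]
    by (auto simp: in_sccs_verts_conv_reachable strongly_connected_def dest: reachable_in_verts)
  then have "num_odd_comps (with_proj G) > 0"
    using card finite_sccs_verts by (auto simp: num_odd_comps_def card_gt_0_iff)
  then have "1 \<le> int (num_odd_comps (with_proj G)) + int k * int (num_isolated (with_proj G))"
    by (intro add_increasing2) simp_all
  then show ?thesis unfolding deficiency_at_def G by simp
qed

lemma generalized_factor_criticalI:
  assumes "odd (card (verts G))" "finite (verts G)"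
    and less: "\<And>S. S \<subseteq> verts G \<Longrightarrow> S \<noteq> {} \<Longrightarrow> deficiency_at k G S < deficiency_at k G {}"
  shows "generalized_factor_critical k G"
proof -
  have "deficiency k G = deficiency_at k G {}"
    unfolding deficiency_def using assms(2) less by (intro Max_eqI) (auto, force)
  then have "k_barrier k G S \<longleftrightarrow> S = {}" for S
    using less[of S] by (cases "S = {}") (auto simp: k_barrier_def)
  then show ?thesis using assms(1) by (simp add: generalized_factor_critical_def)
qed

theorem theorem3p2:
  fixes G :: "'a pair_pre_digraph" and n k :: nat
  assumes "n \<ge> 3" and "odd n" and "k \<ge> 3" and "odd k"
    and "pair_graph G" and "Digraph_Component.connected (with_proj G)"
    and "card (pverts G) = n"
    and "graph_rho (with_proj G) \<ge>
      graph_rho (with_proj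
        (graph_join (complete_graph 1) (disjoint_union (complete_graph (n - 2)) (complete_graph 1))))"
    and "\<not> digraph_iso (with_proj G) (with_proj
        (graph_join (complete_graph 1) (disjoint_union (complete_graph (n - 2)) (complete_graph 1))))"
  shows "generalized_factor_critical k (with_proj G)"
proof (rule generalized_factor_criticalI)
  interpret pair_graph G by fact
  show "odd (card (verts (with_proj G)))" "finite (verts (with_proj G))"
    using assms(2,7) pair_finite_verts by simp_all
  have "real n - 2 < graph_rho (with_proj G)"
    using graph_rho_pendant_clique_gt[of "n - 2"] assms(1,8) by linarith
  then show "deficiency_at k (with_proj G) S < deficiency_at k (with_proj G) {}"
    if "S \<subseteq> verts (with_proj G)" "S \<noteq> {}" for S
    using no_nonempty_set_of_positive_deficiency[OF assms(1) _ assms(5-7) _ assms(9), of k S]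
      deficiency_at_empty_ge[of k] that assms by auto
qed

end
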